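(* Let $d\ge 1$, $f\in C^1(\mathbb{R}_+,\mathbb{R})$, $c(x,y)=f(|x-y|)$ on $\mathbb{R}^d\times\mathbb{R}^d$, and $g(t):=-f'(t)/t$ for $t>0$. Let $A:\mathbb{R}^d\to\mathbb{R}^d$ be affine, $x_0\in\mathbb{R}^d$, and $S_0:=\{y\in\mathbb{R}^d:c_x(x_0,y)=A(y)\}$, with $x_0\in\mathrm{ri}\,\mathrm{conv}\,S_0$. Then $$S_0=\bigcup_{(t,\rho)\in\mathcal{A}}S_t^\rho\ \cup\ \big\{\mathbf{y}(t):t\in\mathbf{fix}(g\circ|\mathbf{y}-x_0|)\big\},$$ where $S_t^\rho:=\mathcal{S}_{V_t}\big(p_t,\sqrt{\rho^2-|p_t-x_0|^2}\big)$, $V_t:=\mathbf{y}(t)+\ker(tI_d-\nabla A)$, $p_t:=\mathrm{proj}_{V_t}(x_0)$, and $$\mathcal{A}:=\big\{(t,\rho):t\in Sp(\nabla A),\ |\mathbf{y}(t)|<\infty,\ g(\rho)=t,\ \rho\ge|p_t-x_0|\big\}.$$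
   Context: $|\cdot|$ is the Euclidean norm; $c_x$ is the gradient in the first variable; on $\{x\ne y\}$, $c_x(x,y)=g(|y-x|)(y-x)$; $c(\cdot,y)$ is differentiable at $x=y$ iff $f'(0)=0$, and then $c_x(x,x)=0$. $\mathrm{ri}\,\mathrm{conv}$ is the relative interior of the convex hull. $\nabla A$ is the matrix of the linear part of $A$ and $Sp(\nabla A)$ its set of eigenvalues. For $a\notin Sp(\nabla A)$ (real), $\mathbf{y}(a):=x_0+(aI_d-\nabla A)^{-1}A(x_0)$. For $a\in Sp(\nabla A)$, if the limit $\lim_{t\to a}\mathbf{y}(t)$ exists, one writes $|\mathbf{y}(a)|<\infty$ and sets $\mathbf{y}(a):=\lim_{t\to a}\mathbf{y}(t)$. $\mathbf{fix}(h)$ is the set of fixed points of $h$; thus $\mathbf{fix}(g\circ|\mathbf{y}-x_0|)$ is the set of $t\in\mathbb{R}$ (where $\mathbf{y}(t)$ is defined) with $g(|\mathbf{y}(t)-x_0|)=t$. For an affine subspace $V$, $\mathcal{S}_V(x,r)$ is the $(\dim V-1)$-dimensional Euclidean sphere in $V$ with center $x$ and radius $r$, and $\mathrm{proj}_V$ is the orthogonal projection onto $V$.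
   Formalization: Since g is defined only for t>0, at parameters t with y(t)=x₀ the value g(0) is taken to be an arbitrary real number if f'(0)=0, and such t are excluded from the fixed-point set if f'(0)≠0. *)

theory Defs
  imports "HOL-Analysis.Analysis"
begin

definition cost :: "(real \<Rightarrow> real) \<Rightarrow> real^'n \<Rightarrow> real^'n \<Rightarrow> real" where
  "cost f x y = f (norm (x - y))"

(* The gradient statement includes differentiability of the cost in its first variable,
   so x0 itself can belong to this set only if cost f _ x0 is differentiable at x0. *)
definition contact_set :: "(real \<Rightarrow> real) \<Rightarrow> (real^'n \<Rightarrow> real^'n) \<Rightarrow> real^'n \<Rightarrow> (real^'n) set" where
  "contact_set f A x0 = {y. GDERIV (\<lambda>x. cost f x y) x0 :> A y}"

definition is_affine :: "(real^'n \<Rightarrow> real^'n) \<Rightarrow> bool" where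
  "is_affine A \<longleftrightarrow> linear (\<lambda>x. A x - A 0)"

definition grad :: "(real^'n \<Rightarrow> real^'n) \<Rightarrow> real^'n^'n" where
  "grad A = matrix (\<lambda>x. A x - A 0)"

(* Only real parameters are tested for membership; a real eigenvalue of a real matrix
   has a real eigenvector. *)
definition Sp :: "real^'n^'n \<Rightarrow> real set" where
  "Sp M = {a. \<exists>v. v \<noteq> 0 \<and> M *v v = a *\<^sub>R v}"

definition y_reg :: "(real^'n \<Rightarrow> real^'n) \<Rightarrow> real^'n \<Rightarrow> real \<Rightarrow> real^'n" where
  "y_reg A x0 a = x0 + matrix_inv (mat a - grad A) *v A x0"

(* In the limits below, the spectrum is finite and the filter "at a" is punctured,
   so only regular values of the parameter are involved. *)
definition y_defined :: "(real^'n \<Rightarrow> real^'n) \<Rightarrow> real^'n \<Rightarrow> real \<Rightarrow> bool" where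
  "y_defined A x0 a \<longleftrightarrow> a \<notin> Sp (grad A) \<or> (\<exists>l. (y_reg A x0 \<longlongrightarrow> l) (at a))"

definition y_pt :: "(real^'n \<Rightarrow> real^'n) \<Rightarrow> real^'n \<Rightarrow> real \<Rightarrow> real^'n" where
  "y_pt A x0 a = (if a \<notin> Sp (grad A) then y_reg A x0 a else Lim (at a) (y_reg A x0))"

definition proj_on :: "(real^'n) set \<Rightarrow> real^'n \<Rightarrow> real^'n" where
  "proj_on V x = (THE p. p \<in> V \<and> (\<forall>v\<in>V. \<forall>w\<in>V. (x - p) \<bullet> (v - w) = 0))"

definition sphere_in :: "(real^'n) set \<Rightarrow> real^'n \<Rightarrow> real \<Rightarrow> (real^'n) set" where
  "sphere_in V x r = {y \<in> V. dist x y = r}"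

definition V_sp :: "(real^'n \<Rightarrow> real^'n) \<Rightarrow> real^'n \<Rightarrow> real \<Rightarrow> (real^'n) set" where
  "V_sp A x0 t = (\<lambda>v. y_pt A x0 t + v) ` {v. (mat t - grad A) *v v = 0}"

definition p_pt :: "(real^'n \<Rightarrow> real^'n) \<Rightarrow> real^'n \<Rightarrow> real \<Rightarrow> real^'n" where
  "p_pt A x0 t = proj_on (V_sp A x0 t) x0"

definition S_sph :: "(real^'n \<Rightarrow> real^'n) \<Rightarrow> real^'n \<Rightarrow> real \<Rightarrow> real \<Rightarrow> (real^'n) set" where
  "S_sph A x0 t \<rho> =
     sphere_in (V_sp A x0 t) (p_pt A x0 t) (sqrt (\<rho>\<^sup>2 - (norm (p_pt A x0 t - x0))\<^sup>2))"

(* g is meaningful on positive arguments only, hence the condition \<rho> > 0. *)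
definition A_set :: "(real \<Rightarrow> real) \<Rightarrow> (real^'n \<Rightarrow> real^'n) \<Rightarrow> real^'n \<Rightarrow> (real \<times> real) set" where
  "A_set g A x0 = {(t, \<rho>). t \<in> Sp (grad A) \<and> y_defined A x0 t \<and> \<rho> > 0 \<and> g \<rho> = t
                            \<and> \<rho> \<ge> norm (p_pt A x0 t - x0)}"

(* Fixed points of g o |y - x0|. The argument 0 occurs where y(t) = x0, which forces
   A x0 = 0. If f'(0) = 0, then c_x(x0,x0) = 0 = r (x0 - x0) for every real r, so
   c_x(x0,y) = g(|y - x0|)(y - x0) holds at y = x0 whatever real value g has at 0;
   that value is left arbitrary. If f'(0) \<noteq> 0, then c_x(x0,x0) does not exist and
   g o |y - x0| counts as undefined at such t. *)
definition fix_set ::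
    "(real \<Rightarrow> real) \<Rightarrow> (real \<Rightarrow> real) \<Rightarrow> (real^'n \<Rightarrow> real^'n) \<Rightarrow> real^'n \<Rightarrow> real set" where
  "fix_set f' g A x0 = {t. y_defined A x0 t \<and> (y_pt A x0 t = x0 \<longrightarrow> f' 0 = 0)
                            \<and> g (norm (y_pt A x0 t - x0)) = t}"

end

theory Submission
  imports Defs
begin

text \<open>For \<open>y \<noteq> x0\<close>, membership of \<open>y\<close> in the contact set means \<open>(t - M) (y - x0) = A x0\<close> with
  \<open>M = grad A\<close> and \<open>t = g (norm (y - x0))\<close>. The linear equation says \<open>y = y(t)\<close> if \<open>t\<close> is regular and
  \<open>y \<in> V\<^sub>t\<close> if \<open>t\<close> is an eigenvalue for which \<open>y(t)\<close> exists, and the sphere then encodes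
  \<open>norm (y - x0) = \<rho>\<close> by Pythagoras. What needs the hypothesis on the relative interior is the existence of
  \<open>y(t)\<close> at an eigenvalue: \<open>x0\<close> is a strictly positive combination of \<open>y\<close> and other contact points
  \<open>x0 + u\<^sub>i\<close>, and \<open>M u\<^sub>i = r\<^sub>i u\<^sub>i - A x0\<close> then makes the restriction of \<open>M\<close> to the span of the \<open>u\<^sub>i\<close>
  self-adjoint for a suitable inner product. So \<open>t\<close> is a semisimple eigenvalue there, and the resolvent
  applied to \<open>A x0\<close>, which lies in the image of \<open>t - M\<close>, stays bounded near \<open>t\<close> and converges.\<close>

section \<open>Finiteness of the spectrum\<close>

text \<open>The witness is the product of the maps \<open>M - r\<close> over \<open>r \<in> F\<close>.\<close>
lemma linear_prod_eigen:
  fixes M :: "'a::real_vector \<Rightarrow> 'a"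
  assumes M: "linear M" and "finite F"
  shows "\<exists>P. linear P \<and> (\<forall>v s. M v = s *\<^sub>R v \<longrightarrow> P v = (\<Prod>r\<in>F. s - r) *\<^sub>R v)"
  using \<open>finite F\<close>
proof (induction F)
  case empty
  then show ?case by (intro exI[of _ "\<lambda>v. v"]) (auto simp: linear_ident)
next
  case (insert a F)
  then obtain P where P: "linear P" "\<And>v s. M v = s *\<^sub>R v \<Longrightarrow> P v = (\<Prod>r\<in>F. s - r) *\<^sub>R v"
    by blast
  have "linear (\<lambda>v. M (P v) - a *\<^sub>R P v)"
    using M P(1) by (auto simp: linear_iff algebra_simps)
  moreover have "M (P v) - a *\<^sub>R P v = (\<Prod>r\<in>insert a F. s - r) *\<^sub>R v" if "M v = s *\<^sub>R v" for v s
    using P(2)[OF that] that insert.hyps M by (simp add: linear_scale algebra_simps)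
  ultimately show ?case by (intro exI[of _ "\<lambda>v. M (P v) - a *\<^sub>R P v"]) blast
qed

text \<open>Eigenvectors for distinct eigenvalues are independent, so a finite set of eigenvalues
  has at most \<open>DIM('a)\<close> elements.\<close>

lemma finite_eigenvalues:
  fixes M :: "'a::euclidean_space \<Rightarrow> 'a"
  assumes M: "linear M"
  shows "finite {s. \<exists>v. v \<noteq> 0 \<and> M v = s *\<^sub>R v}" (is "finite ?E")
proof -
  obtain v where v: "\<And>s. s \<in> ?E \<Longrightarrow> v s \<noteq> 0 \<and> M (v s) = s *\<^sub>R v s"
    by (rule that[of "\<lambda>s. SOME v. v \<noteq> 0 \<and> M v = s *\<^sub>R v"]) (metis (mono_tags, lifting) mem_Collect_eq someI_ex)
  have indep: "independent (v ` F) \<and> card (v ` F) = card F" if "finite F" "F \<subseteq> ?E" for F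
    using that
  proof (induction F)
    case empty
    then show ?case by (simp add: independent_empty)
  next
    case (insert a F)
    obtain P where P: "linear P" "\<And>u s. M u = s *\<^sub>R u \<Longrightarrow> P u = (\<Prod>r\<in>F. s - r) *\<^sub>R u"
      using linear_prod_eigen[OF M insert.hyps(1)] by blast
    \<comment> \<open>For \<open>s\<close> in \<open>F\<close> the product has the factor
      \<open>s - s\<close>, whereas \<open>P\<close> multiplies \<open>v a\<close> by a nonzero
      number because \<open>a\<close> is not in \<open>F\<close>. This keeps \<open>v a\<close> out
      of the span.\<close>
    have "P (v s) = 0" if "s \<in> F" for s
    proof -
      have "P (v s) = (\<Prod>r\<in>F. s - r) *\<^sub>R v s" using P(2)[of "v s" s] v[of s] that insert.prems by auto
      moreover have "(\<Prod>r\<in>F. s - r) = 0" using that insert.hyps(1) by (auto simp: prod_zero_iff)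
      ultimately show ?thesis by simp
    qed
    then have "P u = 0" if "u \<in> span (v ` F)" for u
      using linear_eq_0_on_span[OF P(1) _ that] by blast
    moreover have "P (v a) \<noteq> 0"
      using P(2)[of "v a" a] v[of a] insert by auto
    ultimately have "v a \<notin> span (v ` F)" by blast
    moreover from this have "v a \<notin> v ` F" using span_base[of "v a" "v ` F"] by blast
    ultimately show ?case
      using insert by (simp add: independent_insertI)
  qed
  have "card F \<le> DIM('a)" if "F \<subseteq> ?E" "finite F" for F
    using indep[OF that(2,1)] independent_bound by metis
  then show ?thesis using finite_if_finite_subsets_card_bdd[of ?E "DIM('a)"] by blast
qed

section \<open>Semisimplicity on a span and convergence of the resolvent\<close>

text \<open>\<open>M\<close> maps the range of \<open>N = (\<Sum>i. w i u i u i\<^sup>T)\<close>, which is the span of the \<open>u i\<close>, into itself,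
  and \<open>M N\<close> is symmetric because the rank-one contribution of \<open>b\<close> cancels by \<open>bary\<close>.\<close>
lemma kernel_square_on_span:
  fixes M :: "'a::euclidean_space \<Rightarrow> 'a"
  assumes M: "linear M" and F: "finite F" and w: "\<And>i. i \<in> F \<Longrightarrow> w i > 0"
    and bary: "(\<Sum>i\<in>F. w i *\<^sub>R u i) = 0"
    and r: "\<And>i. i \<in> F \<Longrightarrow> M (u i) = r i *\<^sub>R u i - b"
    and v: "v \<in> span (u ` F)" and sq: "M (M v) = 0"
  shows "M v = 0"
proof -
  define N where "N = (\<lambda>\<phi>. \<Sum>i\<in>F. (w i * (u i \<bullet> \<phi>)) *\<^sub>R u i)"
  have N_form: "\<psi> \<bullet> N \<phi> = (\<Sum>i\<in>F. w i * (u i \<bullet> \<phi>) * (u i \<bullet> \<psi>))" for \<phi> \<psi>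
    by (simp add: N_def inner_sum_right inner_commute mult.commute mult.left_commute)
  have linN: "linear N"
    by (rule linearI)
       (auto simp: N_def algebra_simps sum.distrib scaleR_sum_right)
  \<comment> \<open>The quadratic form of \<open>N\<close> is a sum of nonnegative terms with
    positive weights, so it vanishes only termwise.\<close>
  have N_ker: "u i \<bullet> \<phi> = 0" if "\<phi> \<bullet> N \<phi> = 0" "i \<in> F" for i \<phi>
  proof -
    have "(\<Sum>i\<in>F. w i * (u i \<bullet> \<phi>)\<^sup>2) = 0"
      using that(1) unfolding N_form by (simp add: power2_eq_square mult.assoc)
    then have "w i * (u i \<bullet> \<phi>)\<^sup>2 = 0"
      using F that(2) w by (subst (asm) sum_nonneg_eq_0_iff) (auto simp: less_imp_le)
    then show ?thesis using w[OF that(2)] by simp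
  qed
  \<comment> \<open>Otherwise some nonzero \<open>z\<close> in the span is orthogonal to
    \<open>range N\<close>; then \<open>z \<bullet> N z = 0\<close> makes \<open>z\<close>
    orthogonal to every \<open>u i\<close>, hence to itself.\<close>
  have "span (u ` F) \<subseteq> range N"
  proof (rule ccontr)
    assume "\<not> span (u ` F) \<subseteq> range N"
    moreover have "subspace (range N)"
      using linear_subspace_image[OF linN subspace_UNIV] .
    then have sp: "span (range N) = range N" by simp
    moreover have "N \<phi> \<in> span (u ` F)" for \<phi>
      unfolding N_def by (intro span_sum span_scale span_base) auto
    ultimately have "span (range N) \<subset> span (u ` F)"
      unfolding sp by (auto simp: image_subset_iff)
    then obtain z where z: "z \<noteq> 0" "z \<in> span (u ` F)" "\<And>y. y \<in> span (range N) \<Longrightarrow> orthogonal z y"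
      by (rule orthogonal_to_subspace_exists_gen) iprover
    have "z \<bullet> N z = 0" using z(3)[of "N z"] sp by (auto simp: orthogonal_def)
    then have "\<And>x. x \<in> u ` F \<Longrightarrow> orthogonal z x"
      using N_ker by (auto simp: orthogonal_def inner_commute)
    then have "orthogonal z z" using z(2) orthogonal_to_span by blast
    then show False using z(1) by (simp add: orthogonal_def)
  qed
  then obtain \<phi> where \<phi>: "v = N \<phi>" using v by blast
  have sym: "M (N \<psi>) = N (adjoint M \<psi>)" for \<psi>
  proof -
    have "M (N \<psi>) = (\<Sum>i\<in>F. (w i * (u i \<bullet> \<psi>)) *\<^sub>R (r i *\<^sub>R u i - b))"
      using r by (simp add: N_def linear_sum[OF M] linear_scale[OF M])
    also have "\<dots> = (\<Sum>i\<in>F. (w i * (u i \<bullet> \<psi>) * r i) *\<^sub>R u i) - ((\<Sum>i\<in>F. w i *\<^sub>R u i) \<bullet> \<psi>) *\<^sub>R b"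
      by (simp add: scaleR_diff_right sum_subtractf inner_sum_left scaleR_sum_left)
    also have "\<dots> = (\<Sum>i\<in>F. (w i * (u i \<bullet> \<psi>) * r i) *\<^sub>R u i) - (b \<bullet> \<psi>) *\<^sub>R (\<Sum>i\<in>F. w i *\<^sub>R u i)"
      by (simp add: bary)
    also have "\<dots> = (\<Sum>i\<in>F. (w i * ((r i *\<^sub>R u i - b) \<bullet> \<psi>)) *\<^sub>R u i)"
      by (simp add: algebra_simps sum_subtractf scaleR_sum_right)
    also have "\<dots> = N (adjoint M \<psi>)"
      using r by (simp add: N_def adjoint_works[OF M])
    finally show ?thesis .
  qed
  define \<psi> where "\<psi> = adjoint M \<phi>"
  \<comment> \<open>Here \<open>N \<psi> = M v\<close>, so the right-hand side pairs
    \<open>\<phi>\<close> with \<open>M (M v) = 0\<close>, and \<open>N_ker\<close> applies to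
    \<open>\<psi>\<close>.\<close>
  have "\<psi> \<bullet> N \<psi> = \<phi> \<bullet> M (N \<psi>)"
    by (simp add: \<psi>_def adjoint_clauses[OF M])
  also have "M (N \<psi>) = 0" using sq by (simp add: \<phi> sym \<psi>_def)
  finally have "\<And>i. i \<in> F \<Longrightarrow> u i \<bullet> \<psi> = 0" using N_ker by simp
  then have "N \<psi> = 0" by (simp add: N_def)
  then show ?thesis by (simp add: \<phi> sym \<psi>_def)
qed

text \<open>On \<open>T ` U\<close> the map \<open>T\<close> is injective, hence bounded below, which controls the resolvent of \<open>T\<close>
  up to the eigenvalue.\<close>
lemma resolvent_converges:
  fixes T :: "'a::euclidean_space \<Rightarrow> 'a"
  assumes T: "linear T" and U: "subspace U" and inv: "T ` U \<subseteq> U"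
    and ker: "\<And>v. v \<in> U \<Longrightarrow> T (T v) = 0 \<Longrightarrow> T v = 0"
    and b: "b \<in> T ` U"
    and z: "\<forall>\<^sub>F s in at t. \<forall>x. T x + (s - t) *\<^sub>R x = b \<longleftrightarrow> x = z s"
  shows "\<exists>l. (z \<longlongrightarrow> l) (at t)"
proof -
  define W where "W = T ` U"
  have W: "subspace W" unfolding W_def using linear_subspace_image[OF T U] .
  have TW: "T x \<in> W" if "x \<in> W" for x using that inv by (auto simp: W_def)
  \<comment> \<open>An element of \<open>W\<close> is \<open>T u\<close> with
    \<open>u \<in> U\<close>, so \<open>ker\<close> says that \<open>T\<close> is injective on
    \<open>W\<close>; finite dimension then yields the lower bound \<open>e\<close>.\<close>
  have "\<forall>x\<in>W. T x = 0 \<longrightarrow> x = 0" using ker by (auto simp: W_def)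
  then obtain e where e: "e > 0" "\<And>x. x \<in> W \<Longrightarrow> e * norm x \<le> norm (T x)"
    using injective_imp_isometric[of W T] W T closed_subspace linear_conv_bounded_linear
    by (metis mult.commute)
  have bound: "(e - \<bar>s - t\<bar>) * norm x \<le> norm (T x + (s - t) *\<^sub>R x)" if "x \<in> W" for s x
    using e(2)[OF that] norm_diff_ineq[of "T x" "(s - t) *\<^sub>R x"]
    by (simp add: left_diff_distrib)
  \<comment> \<open>On the invariant space \<open>W\<close>, injectivity from \<open>bound\<close>
    gives surjectivity by dimension. The case \<open>s = t\<close> is included because it produces
    the limit \<open>l\<close>.\<close>
  have solvable: "\<exists>x\<in>W. T x + (s - t) *\<^sub>R x = b" if s: "\<bar>s - t\<bar> < e" for s
  proof -
    let ?L = "\<lambda>x. T x + (s - t) *\<^sub>R x"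
    have L: "linear ?L" using T by (auto simp: linear_iff algebra_simps)
    have "x = 0" if "x \<in> W" "?L x = 0" for x
    proof -
      have "(e - \<bar>s - t\<bar>) * norm x \<le> 0" using bound[of x s] that by simp
      then show ?thesis using s by (simp add: mult_le_0_iff)
    qed
    then have "inj_on ?L (span W)"
      unfolding span_eq_iff[THEN iffD2, OF W] using linear_inj_on_iff_eq_0[OF L W] by blast
    then have "dim (?L ` W) = dim W" by (rule dim_image_eq[OF L])
    moreover have "?L ` W \<subseteq> W" using TW W by (auto intro!: subspace_add subspace_scale)
    ultimately have "?L ` W = W"
      using subspace_dim_equal[OF linear_subspace_image[OF L W] W] by simp
    then have "b \<in> ?L ` W" using b by (simp only: W_def)
    then show ?thesis unfolding image_iff by (simp only: eq_commute)
  qed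
  obtain l where l: "l \<in> W" "T l = b" using solvable[of t] e(1) by auto
  have "\<forall>\<^sub>F s in at t. \<bar>s - t\<bar> < e"
    using e(1) by (auto simp: eventually_at dist_real_def)
  then have ev: "\<forall>\<^sub>F s in at t. norm (z s - l) \<le> \<bar>s - t\<bar> * norm l / (e - \<bar>s - t\<bar>)"
    using z
  proof eventually_elim
    case (elim s)
    \<comment> \<open>Uniqueness identifies \<open>z s\<close> with the solution in
      \<open>W\<close>, so \<open>bound\<close> applies to \<open>z s - l\<close>.\<close>
    then have zs: "z s \<in> W" "T (z s) + (s - t) *\<^sub>R z s = b"
      using solvable[of s] by auto
    then have "T (z s - l) + (s - t) *\<^sub>R (z s - l) = (t - s) *\<^sub>R l"
      using l by (simp add: linear_diff[OF T] algebra_simps)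
    then have "(e - \<bar>s - t\<bar>) * norm (z s - l) \<le> \<bar>s - t\<bar> * norm l"
      using bound[of "z s - l" s] zs(1) l(1) W
      by (simp add: subspace_diff abs_minus_commute)
    then show ?case using elim(1) by (simp add: field_simps)
  qed
  have "((\<lambda>s. \<bar>s - t\<bar> * norm l / (e - \<bar>s - t\<bar>)) \<longlongrightarrow> \<bar>t - t\<bar> * norm l / (e - \<bar>t - t\<bar>)) (at t)"
    using e(1) by (intro tendsto_intros) auto
  then have "((\<lambda>s. z s - l) \<longlongrightarrow> 0) (at t)"
    by (intro Lim_null_comparison[OF ev]) simp
  then show ?thesis using LIM_zero_cancel by blast
qed

section \<open>Positive weights from the relative interior\<close>

lemma rel_interior_convex_hull_weights:
  fixes S :: "'a::euclidean_space set"
  assumes x0: "x0 \<in> rel_interior (convex hull S)" and y: "y \<in> S"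
  obtains F w where "finite F" "F \<subseteq> S" "y \<in> F" "\<And>x. x \<in> F \<Longrightarrow> w x > 0"
    "(\<Sum>x\<in>F. w x *\<^sub>R (x - x0)) = (0::'a)"
proof -
  have yc: "y \<in> convex hull S" using y by (rule hull_inc)
  \<comment> \<open>The segment from \<open>y\<close> to \<open>x0\<close> extends beyond
    \<open>x0\<close> to a point of the hull. Expanding that point as a convex combination and
    solving for \<open>x0\<close> gives \<open>y\<close> the extra weight
    \<open>e - 1\<close>.\<close>
  then obtain e where e: "e > 1" "(1 - e) *\<^sub>R y + e *\<^sub>R x0 \<in> convex hull S"
    using x0 convex_rel_interior_iff[of "convex hull S" x0] y by fastforce
  then obtain G u where G: "finite G" "G \<subseteq> S" "\<forall>x\<in>G. 0 \<le> u x" "sum u G = 1"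
      "(\<Sum>v\<in>G. u v *\<^sub>R v) = (1 - e) *\<^sub>R y + e *\<^sub>R x0"
    by (auto simp: convex_hull_explicit)
  \<comment> \<open>As \<open>y\<close> may also lie in \<open>G\<close>, its two contributions are
    added; \<open>F\<close> discards zero weights.\<close>
  define w where "w x = (if x \<in> G then u x else 0) + (if x = y then e - 1 else 0)" for x
  define F where "F = {x \<in> insert y G. w x > 0}"
  have fin: "finite (insert y G)" using G(1) by simp
  have "(\<Sum>x\<in>F. w x *\<^sub>R (x - x0)) = (\<Sum>x\<in>insert y G. w x *\<^sub>R (x - x0))"
    using G(3) e(1) by (intro sum.mono_neutral_left[OF fin]) (auto simp: F_def w_def not_less split: if_splits)
  also have "\<dots> = (\<Sum>x\<in>insert y G. if x \<in> G then u x *\<^sub>R (x - x0) else 0)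
      + (\<Sum>x\<in>insert y G. if x = y then (e - 1) *\<^sub>R (x - x0) else 0)"
    unfolding sum.distrib[symmetric] by (intro sum.cong) (auto simp: w_def algebra_simps)
  also have "(\<Sum>x\<in>insert y G. if x = y then (e - 1) *\<^sub>R (x - x0) else 0) = (e - 1) *\<^sub>R (y - x0)"
    using fin by (simp only: sum.delta) simp
  also have "(\<Sum>x\<in>insert y G. if x \<in> G then u x *\<^sub>R (x - x0) else 0) = (\<Sum>x\<in>G. u x *\<^sub>R (x - x0))"
    using fin by (intro sum.mono_neutral_cong_right) auto
  also have "\<dots> = (\<Sum>v\<in>G. u v *\<^sub>R v) - sum u G *\<^sub>R x0"
    by (simp add: scaleR_diff_right sum_subtractf scaleR_sum_left)
  also have "\<dots> + (e - 1) *\<^sub>R (y - x0) = 0"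
    by (simp add: G algebra_simps)
  finally have "(\<Sum>x\<in>F. w x *\<^sub>R (x - x0)) = 0" .
  moreover have "y \<in> F" using G(3) e(1) by (auto simp: F_def w_def intro: add_nonneg_pos)
  moreover have "F \<subseteq> S" using G(2) y by (auto simp: F_def)
  ultimately show ?thesis using fin by (intro that[of F w]) (auto simp: F_def)
qed

section \<open>Gradients of radial functions and the contact set\<close>

lemma GDERIV_radial_center_iff:
  fixes a :: "'a::euclidean_space"
  assumes f: "(f has_real_derivative f') (at 0 within {0..})"
  shows "GDERIV (\<lambda>x. f (norm (x - a))) a :> D \<longleftrightarrow> f' = 0 \<and> D = 0"
proof
  assume D: "GDERIV (\<lambda>x. f (norm (x - a))) a :> D"
  \<comment> \<open>Restricting to the ray from \<open>a\<close> in direction \<open>v\<close> gives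
    the right derivative of \<open>f\<close> at 0. Comparing \<open>v\<close> with
    \<open>- v\<close> will force it to vanish.\<close>
  have dir: "v \<bullet> D = f'" if v: "norm v = 1" for v
  proof -
    have "((\<lambda>s. a + s *\<^sub>R v) has_derivative (\<lambda>s. s *\<^sub>R v)) (at 0 within {0..})"
      by (auto intro!: derivative_eq_intros)
    from has_derivative_compose[OF this, of "\<lambda>x. f (norm (x - a))" "\<lambda>h. h \<bullet> D"]
    have "((\<lambda>s. f (norm ((a + s *\<^sub>R v) - a))) has_derivative (\<lambda>s. (s *\<^sub>R v) \<bullet> D)) (at 0 within {0..})"
      using D by (simp add: gderiv_def)
    then have "((\<lambda>s. f (norm (s *\<^sub>R v))) has_real_derivative v \<bullet> D) (at 0 within {0..})"
      by (simp add: has_field_derivative_def mult_commute_abs)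
    then have "(f has_real_derivative v \<bullet> D) (at 0 within {0..})"
      by (rule has_field_derivative_transform_within[where d = 1]) (auto simp: v)
    then show ?thesis
      using f tendsto_unique[OF trivial_limit_at_right_real]
      unfolding has_field_derivative_iff at_within_Ici_at_right by blast
  qed
  obtain v :: 'a where "norm v = 1" using vector_choose_size[of 1] by auto
  then have "f' = 0" using dir[of v] dir[of "- v"] by simp
  moreover have "D = 0"
  proof (rule ccontr)
    assume "D \<noteq> 0"
    then have "sgn D \<bullet> D = 0" using dir[of "sgn D"] \<open>f' = 0\<close> by (simp add: norm_sgn)
    then show False using \<open>D \<noteq> 0\<close> by (simp add: sgn_div_norm)
  qed
  ultimately show "f' = 0 \<and> D = 0" by blast
next
  assume "f' = 0 \<and> D = 0"
  then have f0: "(f has_derivative (\<lambda>_. 0)) (at 0 within {0..})" and D: "D = 0"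
    using f by (auto simp: has_field_derivative_def lambda_zero)
  show "GDERIV (\<lambda>x. f (norm (x - a))) a :> D"
    unfolding gderiv_def D has_derivative_at_alt
  proof (intro conjI allI impI)
    fix e :: real assume "e > 0"
    then obtain d where "d > 0" and
        "\<forall>t\<in>{0..}. norm (t - 0) < d \<longrightarrow> norm (f t - f 0 - 0) \<le> e * norm (t - 0)"
      using f0 unfolding has_derivative_within_alt by blast
    then have d: "d > 0" "\<And>t. t \<ge> 0 \<Longrightarrow> t < d \<Longrightarrow> \<bar>f t - f 0\<bar> \<le> e * t"
      by auto
    show "\<exists>d>0. \<forall>y. norm (y - a) < d \<longrightarrow>
        norm (f (norm (y - a)) - f (norm (a - a)) - (y - a) \<bullet> 0) \<le> e * norm (y - a)"
      using d by (intro exI[of _ d]) auto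
  qed simp
qed

lemma GDERIV_radial:
  fixes x y :: "'a::real_inner"
  assumes "x \<noteq> y" and f: "(f has_real_derivative f') (at (norm (x - y)) within {0..})"
  shows "GDERIV (\<lambda>x. f (norm (x - y))) x :> (- f' / norm (y - x)) *\<^sub>R (y - x)"
proof -
  \<comment> \<open>Away from the end point of the half-line the derivative is two-sided, as the
    chain rule requires.\<close>
  have "norm (x - y) \<in> interior {0..}" using assms(1) by simp
  then have "(f has_real_derivative f') (at (norm (x - y)))"
    using f by (metis at_within_interior)
  moreover have "GDERIV (\<lambda>x. norm (x - y)) x :> sgn (x - y)"
    unfolding gderiv_def
    by (rule has_derivative_compose[where g = norm, OF _ has_derivative_norm])
       (use assms(1) in \<open>auto intro!: derivative_eq_intros\<close>)
  ultimately have "GDERIV (\<lambda>x. f (norm (x - y))) x :> f' *\<^sub>R sgn (x - y)"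
    by (rule GDERIV_DERIV_compose[rotated])
  then show ?thesis
    by (simp add: sgn_div_norm norm_minus_commute divide_inverse algebra_simps)
qed

lemma GDERIV_unique:
  assumes "GDERIV f x :> D" "GDERIV f x :> E"
  shows "D = E"
proof -
  have "(\<lambda>h. h \<bullet> D) = (\<lambda>h. h \<bullet> E)"
    using assms unfolding gderiv_def by (rule has_derivative_unique)
  then have "(D - E) \<bullet> D = (D - E) \<bullet> E" by metis
  then have "(D - E) \<bullet> (D - E) = 0" by (simp only: inner_diff_right[of "D - E"])
  then show ?thesis by simp
qed

lemma mem_contact_set_iff:
  fixes A :: "real^'n \<Rightarrow> real^'n"
  assumes f: "\<And>t. t \<ge> 0 \<Longrightarrow> (f has_real_derivative f' t) (at t within {0..})"
    and g: "\<And>t. t > 0 \<Longrightarrow> g t = - f' t / t"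
  shows "y \<in> contact_set f A x0 \<longleftrightarrow>
    (if y = x0 then f' 0 = 0 \<and> A x0 = 0 else A y = g (norm (y - x0)) *\<^sub>R (y - x0))"
proof (cases "y = x0")
  case True
  then show ?thesis
    using GDERIV_radial_center_iff[OF f, of x0 "A x0"] by (simp add: contact_set_def cost_def)
next
  case False
  have "GDERIV (\<lambda>x. cost f x y) x0 :> g (norm (y - x0)) *\<^sub>R (y - x0)"
    using GDERIV_radial[of x0 y f "f' (norm (x0 - y))"] f False g[of "norm (y - x0)"]
    by (simp add: cost_def norm_minus_commute)
  then show ?thesis
    using False GDERIV_unique by (auto simp: contact_set_def)
qed

section \<open>The points y(t) and the affine spaces V_t\<close>

lemma matrix_vector_mult_mat:
  fixes v :: "real^'n"
  shows "mat t *v v = t *\<^sub>R v"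
proof -
  have "mat t = t *\<^sub>R (mat 1 :: real^'n^'n)" by (simp add: vec_eq_iff mat_def)
  then show ?thesis by (simp add: scaleR_matrix_vector_assoc[symmetric])
qed

lemma is_affine_grad:
  assumes "is_affine A"
  shows "A y = A x + grad A *v (y - x)"
proof -
  have "grad A *v z = A z - A 0" for z
    using assms matrix_works by (fastforce simp: is_affine_def grad_def)
  then show ?thesis by (simp add: matrix_vector_mult_diff_distrib)
qed

lemma finite_Sp: "finite (Sp M)"
  unfolding Sp_def by (rule finite_eigenvalues) simp

text \<open>Limits at \<open>t\<close> may thus use the equation for regular parameters even if
  \<open>t\<close> is an eigenvalue.\<close>

lemma eventually_not_Sp: "\<forall>\<^sub>F s in at t. s \<notin> Sp M"
proof -
  have "\<forall>\<^sub>F s in at t. \<forall>r\<in>Sp M. s \<noteq> r"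
    by (intro eventually_ball_finite finite_Sp ballI eventually_neq_at_within)
  then show ?thesis by eventually_elim blast
qed

text \<open>Trades \<open>matrix_inv\<close> for a uniquely solvable linear equation, which can be
  passed to the limit at eigenvalues.\<close>

lemma y_reg_iff:
  assumes "a \<notin> Sp (grad A)"
  shows "(mat a - grad A) *v (y - x0) = A x0 \<longleftrightarrow> y = y_reg A x0 a"
proof -
  let ?B = "mat a - grad A"
  have "\<forall>x. ?B *v x = 0 \<longrightarrow> x = 0"
    using assms by (auto simp: Sp_def matrix_vector_mult_diff_rdistrib matrix_vector_mult_mat)
  then have "invertible ?B"
    unfolding invertible_left_inverse matrix_left_invertible_ker .
  then have inv: "?B ** matrix_inv ?B = mat 1 \<and> matrix_inv ?B ** ?B = mat 1"
    unfolding invertible_def matrix_inv_def by (rule someI_ex)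
  then have "?B *v (matrix_inv ?B *v A x0) = A x0" "\<And>v. matrix_inv ?B *v (?B *v v) = v"
    by (simp_all only: matrix_vector_mul_assoc matrix_vector_mul_lid)
  then have "?B *v (y - x0) = A x0 \<longleftrightarrow> y - x0 = matrix_inv ?B *v A x0" by metis
  then show ?thesis by (simp add: y_reg_def diff_eq_eq add.commute)
qed

lemma y_reg_tendsto_y_pt:
  assumes "y_defined A x0 t" "t \<in> Sp (grad A)"
  shows "(y_reg A x0 \<longlongrightarrow> y_pt A x0 t) (at t)"
  using assms unfolding y_defined_def y_pt_def by (auto simp: tendsto_Lim)

lemma y_pt_solves:
  assumes "y_defined A x0 t"
  shows "(mat t - grad A) *v (y_pt A x0 t - x0) = A x0"
proof (cases "t \<in> Sp (grad A)")
  case False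
  then show ?thesis using y_reg_iff[OF False, of "y_pt A x0 t" x0] by (simp add: y_pt_def)
next
  case True
  let ?h = "\<lambda>s. (mat s - grad A) *v (y_reg A x0 s - x0)"
  have lim: "(?h \<longlongrightarrow> (mat t - grad A) *v (y_pt A x0 t - x0)) (at t)"
    unfolding matrix_vector_mult_diff_rdistrib matrix_vector_mult_mat
    by (intro tendsto_intros y_reg_tendsto_y_pt[OF assms True]
          bounded_linear.tendsto[OF matrix_vector_mul_bounded_linear])
  have "\<forall>\<^sub>F s in at t. ?h s = A x0"
    using eventually_not_Sp[of "grad A" t] by eventually_elim (simp add: y_reg_iff)
  then have "(?h \<longlongrightarrow> A x0) (at t)" by (rule tendsto_eventually)
  then show ?thesis by (rule tendsto_unique[OF trivial_limit_at lim])
qed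

text \<open>\<open>y_pt\<close> gives a particular solution and the kernel the homogeneous
  ones.\<close>

lemma mem_V_sp_iff:
  assumes "y_defined A x0 t"
  shows "y \<in> V_sp A x0 t \<longleftrightarrow> (mat t - grad A) *v (y - x0) = A x0"
proof -
  have "y \<in> V_sp A x0 t \<longleftrightarrow> (mat t - grad A) *v (y - y_pt A x0 t) = 0"
    by (auto simp: V_sp_def image_iff)
  also have "y - y_pt A x0 t = (y - x0) - (y_pt A x0 t - x0)" by simp
  also have "(mat t - grad A) *v \<dots> = (mat t - grad A) *v (y - x0) - A x0"
    by (subst matrix_vector_mult_diff_distrib[of _ "y - x0"]) (simp only: y_pt_solves[OF assms])
  finally show ?thesis by simp
qed

section \<open>Orthogonal projection and spheres\<close>

lemma proj_on_translate:
  fixes K :: "(real^'n) set" and a x :: "real^'n"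
  assumes K: "subspace K"
  defines "V \<equiv> (\<lambda>v. a + v) ` K"
  shows "proj_on V x \<in> V \<and> (\<forall>v\<in>V. \<forall>w\<in>V. (x - proj_on V x) \<bullet> (v - w) = 0)"
proof -
  obtain y z where yz: "y \<in> K" "\<And>w. w \<in> K \<Longrightarrow> orthogonal z w" "x - a = y + z"
    using orthogonal_subspace_decomp_exists[of K "x - a"] span_eq_iff[THEN iffD2, OF K] by metis
  have xz: "x - (a + y) = z" using yz(3) by (simp add: algebra_simps)
  have "(x - (a + y)) \<bullet> (v - w) = 0" if "v \<in> V" "w \<in> V" for v w
  proof -
    have "v - w \<in> K" using that K by (auto simp: V_def subspace_diff)
    then show ?thesis using yz(2) unfolding xz by (simp add: orthogonal_def)
  qed
  moreover have "a + y \<in> V" using yz(1) by (simp add: V_def)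
  \<comment> \<open>Uniqueness lets the definite description in \<open>proj_on\<close> denote this
    point.\<close>
  moreover have "p = q"
    if "p \<in> V" "\<forall>v\<in>V. \<forall>w\<in>V. (x - p) \<bullet> (v - w) = 0"
       "q \<in> V" "\<forall>v\<in>V. \<forall>w\<in>V. (x - q) \<bullet> (v - w) = 0" for p q
  proof -
    have "(x - p) \<bullet> (q - p) = 0" "(x - q) \<bullet> (q - p) = 0" using that by auto
    then have "(q - p) \<bullet> (q - p) = 0" by (simp add: inner_diff_left)
    then show ?thesis by simp
  qed
  ultimately have "\<exists>!p. p \<in> V \<and> (\<forall>v\<in>V. \<forall>w\<in>V. (x - p) \<bullet> (v - w) = 0)" by blast
  then show ?thesis unfolding proj_on_def by (rule theI')
qed

lemma pythagoras_p_pt: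
  assumes "y \<in> V_sp A x0 t"
  shows "(norm (y - x0))\<^sup>2 = (norm (p_pt A x0 t - x0))\<^sup>2 + (dist (p_pt A x0 t) y)\<^sup>2"
proof -
  let ?p = "p_pt A x0 t"
  have "subspace {v. (mat t - grad A) *v v = 0}"
    by (auto simp: subspace_def algebra_simps)
  from proj_on_translate[OF this, of "y_pt A x0 t" x0]
  have "(x0 - ?p) \<bullet> (?p - y) = 0"
    using assms by (auto simp: p_pt_def V_sp_def)
  then have "orthogonal (x0 - ?p) (?p - y)" by (simp add: orthogonal_def)
  from norm_add_Pythagorean[OF this]
  show ?thesis by (simp add: dist_norm norm_minus_commute[of x0])
qed

text \<open>The bound on \<open>\<rho>\<close> keeps the radicand nonnegative, so squaring loses
  nothing; Pythagoras converts distance from the centre into distance from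
  \<open>x0\<close>.\<close>

lemma mem_S_sph_iff:
  assumes "\<rho> \<ge> norm (p_pt A x0 t - x0)"
  shows "y \<in> S_sph A x0 t \<rho> \<longleftrightarrow> y \<in> V_sp A x0 t \<and> norm (y - x0) = \<rho>"
proof -
  let ?p = "p_pt A x0 t"
  have \<rho>: "\<rho> \<ge> 0" using assms norm_ge_zero order_trans by blast
  have sq: "(norm (?p - x0))\<^sup>2 \<le> \<rho>\<^sup>2" using assms by (simp add: power_mono)
  have "dist ?p y = sqrt (\<rho>\<^sup>2 - (norm (?p - x0))\<^sup>2) \<longleftrightarrow> norm (y - x0) = \<rho>"
    if "y \<in> V_sp A x0 t"
  proof -
    have "dist ?p y = sqrt (\<rho>\<^sup>2 - (norm (?p - x0))\<^sup>2) \<longleftrightarrow> (dist ?p y)\<^sup>2 = \<rho>\<^sup>2 - (norm (?p - x0))\<^sup>2"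
    proof
      assume "dist ?p y = sqrt (\<rho>\<^sup>2 - (norm (?p - x0))\<^sup>2)"
      then show "(dist ?p y)\<^sup>2 = \<rho>\<^sup>2 - (norm (?p - x0))\<^sup>2"
        using sq by (simp only: real_sqrt_pow2 diff_ge_0_iff_ge)
    next
      assume "(dist ?p y)\<^sup>2 = \<rho>\<^sup>2 - (norm (?p - x0))\<^sup>2"
      then show "dist ?p y = sqrt (\<rho>\<^sup>2 - (norm (?p - x0))\<^sup>2)"
        by (rule real_sqrt_unique[symmetric]) simp
    qed
    also have "\<dots> \<longleftrightarrow> (norm (y - x0))\<^sup>2 = \<rho>\<^sup>2"
      using pythagoras_p_pt[OF that] by auto
    also have "\<dots> \<longleftrightarrow> norm (y - x0) = \<rho>"
      using \<rho> by (simp add: power2_eq_iff_nonneg)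
    finally show ?thesis .
  qed
  then show ?thesis by (auto simp: S_sph_def sphere_in_def)
qed

section \<open>Existence of y(t) at contact points\<close>

lemma y_defined_if_contact:
  fixes A :: "real^'n \<Rightarrow> real^'n"
  assumes A: "is_affine A"
    and eq: "\<And>y. y \<in> S \<Longrightarrow> A y = r y *\<^sub>R (y - x0)"
    and x0: "x0 \<in> rel_interior (convex hull S)"
    and y: "y \<in> S" and sol: "(mat t - grad A) *v (y - x0) = A x0"
  shows "y_defined A x0 t"
proof -
  obtain F w where F: "finite F" "F \<subseteq> S" "y \<in> F" "\<And>x. x \<in> F \<Longrightarrow> w x > 0"
    "(\<Sum>x\<in>F. w x *\<^sub>R (x - x0)) = 0"
    using rel_interior_convex_hull_weights[OF x0 y] by metis
  define T where "T = (\<lambda>v. (mat t - grad A) *v v)"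
  have T: "linear T" unfolding T_def by simp
  define U where "U = span ((\<lambda>x. x - x0) ` F)"
  have U: "subspace U" by (simp add: U_def)
  have u_in: "x - x0 \<in> U" if "x \<in> F" for x using that by (auto simp: U_def intro: span_base)
  \<comment> \<open>This is the form required by \<open>kernel_square_on_span\<close>, with
    \<open>T\<close> for \<open>M\<close>, the numbers \<open>t - r x\<close> and the vector
    \<open>- A x0\<close>.\<close>
  have Tu: "T (x - x0) = (t - r x) *\<^sub>R (x - x0) - (- A x0)" if "x \<in> F" for x
    using eq[of x] F(2) that is_affine_grad[OF A, of x x0]
    by (auto simp: T_def matrix_vector_mult_diff_rdistrib matrix_vector_mult_mat algebra_simps)
  \<comment> \<open>Applying \<open>T\<close> to the vanishing weighted sum isolates a positive
    multiple of \<open>A x0\<close>.\<close>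
  have b: "A x0 \<in> U"
  proof -
    have "0 = T (\<Sum>x\<in>F. w x *\<^sub>R (x - x0))" by (simp add: F(5) linear_0[OF T])
    also have "\<dots> = (\<Sum>x\<in>F. w x *\<^sub>R T (x - x0))"
      by (simp add: linear_sum[OF T] linear_scale[OF T])
    also have "\<dots> = (\<Sum>x\<in>F. (w x * (t - r x)) *\<^sub>R (x - x0)) + sum w F *\<^sub>R A x0"
      by (simp add: Tu scaleR_add_right sum.distrib scaleR_sum_left)
    finally have "sum w F *\<^sub>R A x0 = - (\<Sum>x\<in>F. (w x * (t - r x)) *\<^sub>R (x - x0))"
      by (simp add: eq_neg_iff_add_eq_0 add.commute)
    also have "\<dots> \<in> U" using U u_in by (intro subspace_neg subspace_sum subspace_scale)
    finally have "(1 / sum w F) *\<^sub>R sum w F *\<^sub>R A x0 \<in> U" by (rule subspace_scale[OF U])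
    moreover have "sum w F > 0" using F by (intro sum_pos) auto
    ultimately show ?thesis by simp
  qed
  have inv: "T ` U \<subseteq> U"
  proof -
    have "T (x - x0) \<in> U" if "x \<in> F" for x
      unfolding Tu[OF that]
      using subspace_diff[OF U subspace_scale[OF U u_in[OF that]] subspace_neg[OF U b]] .
    then have "T ` (\<lambda>x. x - x0) ` F \<subseteq> U" by blast
    then show ?thesis unfolding U_def linear_span_image[OF T, symmetric]
      by (simp add: span_minimal)
  qed
  have ker: "T v = 0" if "v \<in> U" "T (T v) = 0" for v
    using kernel_square_on_span[where F = F and u = "\<lambda>x. x - x0", OF T F(1) F(4) F(5) Tu] that
    unfolding U_def by blast
  have bT: "A x0 \<in> T ` U"
    using imageI[OF u_in[OF F(3)], of T] sol by (simp only: T_def)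
  have "\<forall>\<^sub>F s in at t. \<forall>x. T x + (s - t) *\<^sub>R x = A x0 \<longleftrightarrow> x = y_reg A x0 s - x0"
    using eventually_not_Sp[of "grad A" t]
  proof eventually_elim
    case (elim s)
    have "T x + (s - t) *\<^sub>R x = (mat s - grad A) *v ((x0 + x) - x0)" for x
      by (simp add: T_def matrix_vector_mult_diff_rdistrib matrix_vector_mult_mat algebra_simps)
    then show ?case by (simp only: y_reg_iff[OF elim]) (simp add: eq_diff_eq add.commute)
  qed
  from resolvent_converges[OF T U inv ker bT this]
  obtain l where "((\<lambda>s. y_reg A x0 s - x0) \<longlongrightarrow> l) (at t)" by blast
  then have "((\<lambda>s. y_reg A x0 s - x0 + x0) \<longlongrightarrow> l + x0) (at t)"
    by (intro tendsto_intros)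
  then show ?thesis by (auto simp: y_defined_def)
qed

section \<open>The two inclusions\<close>

theorem theorem2p20:
  fixes f f' g :: "real \<Rightarrow> real"
    and A :: "real^'n \<Rightarrow> real^'n"
    and x0 :: "real^'n"
  assumes f_deriv: "\<And>t. t \<ge> 0 \<Longrightarrow> (f has_real_derivative f' t) (at t within {0..})"
    and f_C1: "continuous_on {0..} f'"
    and g_def: "\<And>t. t > 0 \<Longrightarrow> g t = - f' t / t"
    and A_affine: "is_affine A"
    and x0_ri: "x0 \<in> rel_interior (convex hull (contact_set f A x0))"
  shows "contact_set f A x0 =
           (\<Union>(t, \<rho>) \<in> A_set g A x0. S_sph A x0 t \<rho>) \<union> y_pt A x0 ` fix_set f' g A x0"
    (is "?S = ?R")
proof
  have mem: "y \<in> ?S \<longleftrightarrow>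
    (if y = x0 then f' 0 = 0 \<and> A x0 = 0 else A y = g (norm (y - x0)) *\<^sub>R (y - x0))" for y
    using f_deriv g_def by (rule mem_contact_set_iff)
  have solves_iff: "(mat t - grad A) *v (y - x0) = A x0 \<longleftrightarrow> A y = t *\<^sub>R (y - x0)" for t y
    unfolding matrix_vector_mult_diff_rdistrib matrix_vector_mult_mat
    using is_affine_grad[OF A_affine, of y x0] by (metis diff_eq_eq)
  have eq: "A y = g (norm (y - x0)) *\<^sub>R (y - x0)" if "y \<in> ?S" for y
    using that mem[of y] by (auto split: if_splits)
  show "?S \<subseteq> ?R"
  proof
    fix y assume y: "y \<in> ?S"
    \<comment> \<open>At \<open>y = x0\<close> this is the unspecified value \<open>g 0\<close>; the
      equation for \<open>y\<close> still holds, both sides being zero.\<close>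
    define t where "t = g (norm (y - x0))"
    have sol: "(mat t - grad A) *v (y - x0) = A x0"
      using eq[OF y] by (simp add: solves_iff t_def)
    have def: "y_defined A x0 t"
      using y_defined_if_contact[OF A_affine eq x0_ri y sol] .
    show "y \<in> ?R"
    \<comment> \<open>\<open>A_set\<close> demands a positive radius, so \<open>y = x0\<close> goes
      to the fixed points even when \<open>t\<close> is an eigenvalue.\<close>
    proof (cases "t \<in> Sp (grad A) \<and> y \<noteq> x0")
      case True
      have V: "y \<in> V_sp A x0 t" using sol mem_V_sp_iff[OF def] by blast
      have "norm (p_pt A x0 t - x0) \<le> norm (y - x0)"
        using pythagoras_p_pt[OF V] by (intro power2_le_imp_le[OF _ norm_ge_zero]) simp
      moreover from this have "y \<in> S_sph A x0 t (norm (y - x0))"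
        using V by (simp add: mem_S_sph_iff)
      ultimately show ?thesis using True def by (auto simp: A_set_def t_def)
    next
      case False
      have "y_pt A x0 t = y"
      proof (cases "t \<in> Sp (grad A)")
        case True
        with False have "y = x0" by simp
        \<comment> \<open>Here \<open>A x0 = 0\<close>, so the regular formula is constant and its
          limit is \<open>x0\<close>.\<close>
        then have "y_reg A x0 = (\<lambda>_. x0)" using y mem[of y] by (simp add: y_reg_def fun_eq_iff)
        then have "(y_reg A x0 \<longlongrightarrow> x0) (at t)" by simp
        then show ?thesis
          using tendsto_unique[OF trivial_limit_at y_reg_tendsto_y_pt[OF def True]] \<open>y = x0\<close>
          by blast
      next
        case False
        then show ?thesis using y_reg_iff[OF False, of y x0] sol by (simp only: y_pt_def) simp
      qed
      moreover have "t \<in> fix_set f' g A x0"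
        using def calculation y mem[of y] by (auto simp: fix_set_def t_def)
      ultimately show ?thesis by blast
    qed
  qed
  show "?R \<subseteq> ?S"
  proof
    fix y assume "y \<in> ?R"
    then consider t \<rho> where "(t, \<rho>) \<in> A_set g A x0" "y \<in> S_sph A x0 t \<rho>"
      | t where "t \<in> fix_set f' g A x0" "y = y_pt A x0 t"
      by auto
    then show "y \<in> ?S"
    proof cases
      case 1
      then have "y_defined A x0 t" "\<rho> > 0" "g \<rho> = t" "y \<in> V_sp A x0 t" "norm (y - x0) = \<rho>"
        by (auto simp: A_set_def mem_S_sph_iff)
      \<comment> \<open>\<open>\<rho> > 0\<close> excludes \<open>y = x0\<close>.\<close>
      then show ?thesis using mem[of y] by (auto simp: mem_V_sp_iff solves_iff)
    next
      case 2
      then have "A y = t *\<^sub>R (y - x0)" "g (norm (y - x0)) = t" "y = x0 \<longrightarrow> f' 0 = 0"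
        using y_pt_solves[of A x0 t] solves_iff[of t y] by (auto simp only: fix_set_def mem_Collect_eq)
      \<comment> \<open>If \<open>y = x0\<close>, the first equation gives \<open>A x0 = 0\<close>
        and the guard in \<open>fix_set\<close> gives \<open>f' 0 = 0\<close>.\<close>
      then show ?thesis using mem[of y] by auto
    qed
  qed
qed

end
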